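(* Let $\mathcal{H}$ be a complex Hilbert space with inner product $\langle\cdot|\cdot\rangle$, $\mathcal{D}$ a dense subspace of $\mathcal{H}$, and $\Omega$ a sesquilinear form on $\mathcal{D}$ which is solvable with respect to a norm $\|\cdot\|_\Omega$ induced by an inner product $\langle\cdot|\cdot\rangle_\Omega$ on $\mathcal{D}$. Let $R$ be the positive self-adjoint operator in $\mathcal{H}$ with $0\in\rho(R)$, $D(R)\subseteq D(R^{1/2})=\mathcal{D}$, $\langle\xi|\eta\rangle_\Omega=\langle R\xi|\eta\rangle$ for all $\xi\in D(R)$, $\eta\in\mathcal{D}$, and $\langle\xi|\eta\rangle_\Omega=\langle R^{1/2}\xi|R^{1/2}\eta\rangle$ for all $\xi,\eta\in\mathcal{D}$. Let $A$ be the bounded operator on the Hilbert space $\mathcal{E}_\Omega=\mathcal{D}[\langle\cdot|\cdot\rangle_\Omega]$ such that $\Omega(\xi,\eta)=\langle A\xi|\eta\rangle_\Omega$ for all $\xi,\eta\in\mathcal{D}$. Then the operator $T$ associated to $\Omega$ is $T=RA$, with domain $D(T)=D(RA)=\{\xi\in\mathcal{D}:A\xi\in D(R)\}$.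
   Context: Let $\|\cdot\|$ be the norm of $\mathcal{H}$. Sesquilinear forms are linear in the first variable and conjugate linear in the second; $\rho(\cdot)$ denotes the resolvent set. The operator $R$ exists by Kato's First and Second Representation Theorems, since $\langle\cdot|\cdot\rangle_\Omega$ is a closed positive form on $\mathcal{D}$ with strictly positive lower bound. A sesquilinear form $\Omega$ on the dense subspace $\mathcal{D}$ is q-closed with respect to a norm $\|\cdot\|_\Omega$ on $\mathcal{D}$ if: (1) there is $\alpha>0$ with $\|\xi\|\le\alpha\|\xi\|_\Omega$ for all $\xi\in\mathcal{D}$; (2) if $\{\xi_n\}\subset\mathcal{D}$, $\|\xi_n\|\to0$ and $\|\xi_n-\xi_m\|_\Omega\to0$, then $\|\xi_n\|_\Omega\to0$; (3) $\mathcal{E}_\Omega:=\mathcal{D}[\|\cdot\|_\Omega]$ is a reflexive Banach space; (4) there is $\beta>0$ with $|\Omega(\xi,\eta)|\le\beta\|\xi\|_\Omega\|\eta\|_\Omega$ for all $\xi,\eta\in\mathcal{D}$. Let $\mathcal{E}_\Omega^\times$ be the conjugate dual of $\mathcal{E}_\Omega$ (bounded conjugate linear functionals). $\mathfrak{P}(\Omega)$ is the set of bounded sesquilinear forms $\Upsilon$ on $\mathcal{H}$ such that (i) if $\xi\in\mathcal{D}$ and $(\Omega+\Upsilon)(\xi,\eta)=0$ for all $\eta\in\mathcal{D}$, then $\xi=0$; (ii) for every $\Lambda\in\mathcal{E}_\Omega^\times$ there is $\xi\in\mathcal{D}$ with $\Lambda(\eta)=(\Omega+\Upsilon)(\xi,\eta)$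 for all $\eta\in\mathcal{D}$. $\Omega$ is solvable with respect to $\|\cdot\|_\Omega$ if it is q-closed with respect to $\|\cdot\|_\Omega$ and $\mathfrak{P}(\Omega)\neq\varnothing$. The operator associated to a solvable form $\Omega$ is the (closed, densely defined) operator $T$ with $D(T)=\{\xi\in\mathcal{D}:\exists\,\chi\in\mathcal{H}\text{ with }\Omega(\xi,\eta)=\langle\chi|\eta\rangle\ \forall\eta\in\mathcal{D}\}$ and $T\xi=\chi$; it is the greatest operator $T$ with $D(T)\subseteq\mathcal{D}$ and $\Omega(\xi,\eta)=\langle T\xi|\eta\rangle$ for all $\xi\in D(T)$, $\eta\in\mathcal{D}$. *)

theory Defs
  imports "HOL-Analysis.Analysis" "HOL-Library.Function_Algebras"
begin

section \<open>Complex vector spaces and complex Hilbert spaces\<close>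

class scaleC =
  fixes scaleC :: "complex \<Rightarrow> 'a \<Rightarrow> 'a" (infixr "*\<^sub>C" 75)

class complex_vector = scaleC + ab_group_add +
  assumes scaleC_add_right: "a *\<^sub>C (x + y) = a *\<^sub>C x + a *\<^sub>C y"
    and scaleC_add_left: "(a + b) *\<^sub>C x = a *\<^sub>C x + b *\<^sub>C x"
    and scaleC_scaleC: "a *\<^sub>C (b *\<^sub>C x) = (a * b) *\<^sub>C x"
    and scaleC_one: "1 *\<^sub>C x = x"

global_interpretation complex_vector:
  vector_space "scaleC :: complex \<Rightarrow> 'a \<Rightarrow> 'a::complex_vector"
  defines csubspace = complex_vector.subspace
  by unfold_locales
    (simp_all add: scaleC_add_right scaleC_add_left scaleC_scaleC scaleC_one)

instantiation complex :: complex_vector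
begin
definition scaleC_complex_def: "scaleC a (x::complex) = a * x"
instance
  by standard (simp_all add: scaleC_complex_def algebra_simps)
end

instantiation "fun" :: (type, complex_vector) complex_vector
begin
definition scaleC_fun_def: "scaleC a f = (\<lambda>x. a *\<^sub>C f x)"
instance
  by standard
    (simp_all add: scaleC_fun_def fun_eq_iff scaleC_add_right scaleC_add_left scaleC_scaleC scaleC_one)
end

instantiation prod :: (complex_vector, complex_vector) complex_vector
begin
definition scaleC_prod_def: "scaleC a p = (a *\<^sub>C fst p, a *\<^sub>C snd p)"
instance
  by standard
    (simp_all add: scaleC_prod_def prod_eq_iff scaleC_add_right scaleC_add_left scaleC_scaleC scaleC_one)
end

text \<open>The inner product is linear in the first argument. The axiom \<open>cinner_self\<close> says both that it is
  positive definite and that it induces the norm; completeness comes from \<^class>\<open>banach\<close>.\<close>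

class chilbert_space = complex_vector + banach +
  fixes cinner :: "'a \<Rightarrow> 'a \<Rightarrow> complex"
  assumes scaleR_scaleC: "r *\<^sub>R x = complex_of_real r *\<^sub>C x"
    and cinner_add_left: "cinner (x + y) z = cinner x z + cinner y z"
    and cinner_scaleC_left: "cinner (a *\<^sub>C x) y = a * cinner x y"
    and cinner_commute: "cinner x y = cnj (cinner y x)"
    and cinner_self: "cinner x x = complex_of_real ((norm x)\<^sup>2)"

instantiation complex :: chilbert_space
begin
definition cinner_complex_def: "cinner x (y::complex) = x * cnj y"
instance
  by standard
    (simp_all add: cinner_complex_def scaleC_complex_def scaleR_conv_of_real algebra_simps
      complex_norm_square del: of_real_power)
end


section \<open>Maps on a subspace and norms on a subspace\<close>

text \<open>Subspaces are sets; functions are total in HOL, but only their values on the subspace matter.\<close>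

definition clinear_on :: "'a::complex_vector set \<Rightarrow> ('a \<Rightarrow> 'b::complex_vector) \<Rightarrow> bool" where
  "clinear_on V f \<longleftrightarrow>
     (\<forall>x\<in>V. \<forall>y\<in>V. f (x + y) = f x + f y) \<and> (\<forall>c. \<forall>x\<in>V. f (c *\<^sub>C x) = c *\<^sub>C f x)"

definition antilinear_on :: "'a::complex_vector set \<Rightarrow> ('a \<Rightarrow> 'b::complex_vector) \<Rightarrow> bool" where
  "antilinear_on V f \<longleftrightarrow>
     (\<forall>x\<in>V. \<forall>y\<in>V. f (x + y) = f x + f y) \<and> (\<forall>c. \<forall>x\<in>V. f (c *\<^sub>C x) = cnj c *\<^sub>C f x)"

definition sesquilinear_on :: "'a::complex_vector set \<Rightarrow> ('a \<Rightarrow> 'a \<Rightarrow> complex) \<Rightarrow> bool" where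
  "sesquilinear_on V \<Omega> \<longleftrightarrow>
     (\<forall>\<eta>\<in>V. clinear_on V (\<lambda>\<xi>. \<Omega> \<xi> \<eta>)) \<and> (\<forall>\<xi>\<in>V. antilinear_on V (\<Omega> \<xi>))"

definition inner_product_on :: "'a::complex_vector set \<Rightarrow> ('a \<Rightarrow> 'a \<Rightarrow> complex) \<Rightarrow> bool" where
  "inner_product_on V ip \<longleftrightarrow>
     sesquilinear_on V ip \<and>
     (\<forall>\<xi>\<in>V. \<forall>\<eta>\<in>V. ip \<xi> \<eta> = cnj (ip \<eta> \<xi>)) \<and>
     (\<forall>\<xi>\<in>V. ip \<xi> \<xi> \<in> \<real>\<^sub>\<ge>\<^sub>0 \<and> (ip \<xi> \<xi> = 0 \<longrightarrow> \<xi> = 0))"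

definition induced_norm :: "('a \<Rightarrow> 'a \<Rightarrow> complex) \<Rightarrow> 'a \<Rightarrow> real" where
  "induced_norm ip \<xi> = sqrt (Re (ip \<xi> \<xi>))"

definition norm_on :: "'a::complex_vector set \<Rightarrow> ('a \<Rightarrow> real) \<Rightarrow> bool" where
  "norm_on V N \<longleftrightarrow>
     (\<forall>x\<in>V. 0 \<le> N x \<and> (N x = 0 \<longleftrightarrow> x = 0)) \<and>
     (\<forall>x\<in>V. \<forall>y\<in>V. N (x + y) \<le> N x + N y) \<and>
     (\<forall>c. \<forall>x\<in>V. N (c *\<^sub>C x) = cmod c * N x)"

definition Cauchy_wrt :: "('a::complex_vector \<Rightarrow> real) \<Rightarrow> (nat \<Rightarrow> 'a) \<Rightarrow> bool" where
  "Cauchy_wrt N X \<longleftrightarrow> (\<forall>e>0. \<exists>M. \<forall>m\<ge>M. \<forall>n\<ge>M. N (X m - X n) < e)"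

definition complete_wrt :: "'a::complex_vector set \<Rightarrow> ('a \<Rightarrow> real) \<Rightarrow> bool" where
  "complete_wrt V N \<longleftrightarrow>
     (\<forall>X. (\<forall>n. X n \<in> V) \<and> Cauchy_wrt N X \<longrightarrow> (\<exists>x\<in>V. (\<lambda>n. N (X n - x)) \<longlonglongrightarrow> 0))"

text \<open>The dual of \<open>(V, N)\<close>. Functionals are set to \<open>0\<close> outside \<open>V\<close>, so that distinct elements of the
  set are distinct functionals on \<open>V\<close> and the pointwise operations of the function type are the
  vector space operations of the dual.\<close>

definition dual_space :: "'a::complex_vector set \<Rightarrow> ('a \<Rightarrow> real) \<Rightarrow> ('a \<Rightarrow> complex) set" where
  "dual_space V N =
     {f. clinear_on V f \<and> (\<exists>C. \<forall>x\<in>V. cmod (f x) \<le> C * N x) \<and> (\<forall>x. x \<notin> V \<longrightarrow> f x = 0)}"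

definition dual_norm :: "'a::complex_vector set \<Rightarrow> ('a \<Rightarrow> real) \<Rightarrow> ('a \<Rightarrow> complex) \<Rightarrow> real" where
  "dual_norm V N f = (SUP x\<in>{x\<in>V. N x \<le> 1}. cmod (f x))"

definition reflexive_banach :: "'a::complex_vector set \<Rightarrow> ('a \<Rightarrow> real) \<Rightarrow> bool" where
  "reflexive_banach V N \<longleftrightarrow>
     csubspace V \<and> norm_on V N \<and> complete_wrt V N \<and>
     (\<forall>\<Phi>\<in>dual_space (dual_space V N) (dual_norm V N). \<exists>x\<in>V. \<forall>f\<in>dual_space V N. \<Phi> f = f x)"

definition conjugate_dual :: "'a::complex_vector set \<Rightarrow> ('a \<Rightarrow> real) \<Rightarrow> ('a \<Rightarrow> complex) set" where
  "conjugate_dual V N =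
     {f. antilinear_on V f \<and> (\<exists>C. \<forall>x\<in>V. cmod (f x) \<le> C * N x) \<and> (\<forall>x. x \<notin> V \<longrightarrow> f x = 0)}"

definition bounded_operator_on ::
    "'a::complex_vector set \<Rightarrow> ('a \<Rightarrow> real) \<Rightarrow> ('a \<Rightarrow> 'a) \<Rightarrow> bool" where
  "bounded_operator_on V N A \<longleftrightarrow>
     A ` V \<subseteq> V \<and> clinear_on V A \<and> (\<exists>C. \<forall>x\<in>V. N (A x) \<le> C * N x)"


section \<open>Solvable forms\<close>

definition q_closed ::
    "'a::chilbert_space set \<Rightarrow> ('a \<Rightarrow> 'a \<Rightarrow> complex) \<Rightarrow> ('a \<Rightarrow> real) \<Rightarrow> bool" where
  "q_closed D \<Omega> N \<longleftrightarrow>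
     csubspace D \<and> closure D = UNIV \<and> sesquilinear_on D \<Omega> \<and> norm_on D N \<and>
     (\<exists>\<alpha>>0. \<forall>\<xi>\<in>D. norm \<xi> \<le> \<alpha> * N \<xi>) \<and>
     (\<forall>X. (\<forall>n. X n \<in> D) \<and> (\<lambda>n. norm (X n)) \<longlonglongrightarrow> 0 \<and> Cauchy_wrt N X \<longrightarrow>
        (\<lambda>n. N (X n)) \<longlonglongrightarrow> 0) \<and>
     reflexive_banach D N \<and>
     (\<exists>\<beta>>0. \<forall>\<xi>\<in>D. \<forall>\<eta>\<in>D. cmod (\<Omega> \<xi> \<eta>) \<le> \<beta> * N \<xi> * N \<eta>)"

definition bounded_form :: "('a::chilbert_space \<Rightarrow> 'a \<Rightarrow> complex) \<Rightarrow> bool" where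
  "bounded_form \<Upsilon> \<longleftrightarrow>
     sesquilinear_on UNIV \<Upsilon> \<and> (\<exists>C. \<forall>\<xi> \<eta>. cmod (\<Upsilon> \<xi> \<eta>) \<le> C * norm \<xi> * norm \<eta>)"

definition solving_perturbations ::
    "'a::chilbert_space set \<Rightarrow> ('a \<Rightarrow> 'a \<Rightarrow> complex) \<Rightarrow> ('a \<Rightarrow> real) \<Rightarrow> ('a \<Rightarrow> 'a \<Rightarrow> complex) set" where
  "solving_perturbations D \<Omega> N =
     {\<Upsilon>. bounded_form \<Upsilon> \<and>
        (\<forall>\<xi>\<in>D. (\<forall>\<eta>\<in>D. \<Omega> \<xi> \<eta> + \<Upsilon> \<xi> \<eta> = 0) \<longrightarrow> \<xi> = 0) \<and>
        (\<forall>\<Lambda>\<in>conjugate_dual D N. \<exists>\<xi>\<in>D. \<forall>\<eta>\<in>D. \<Lambda> \<eta> = \<Omega> \<xi> \<eta> + \<Upsilon> \<xi> \<eta>)}"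

definition solvable ::
    "'a::chilbert_space set \<Rightarrow> ('a \<Rightarrow> 'a \<Rightarrow> complex) \<Rightarrow> ('a \<Rightarrow> real) \<Rightarrow> bool" where
  "solvable D \<Omega> N \<longleftrightarrow> q_closed D \<Omega> N \<and> solving_perturbations D \<Omega> N \<noteq> {}"


section \<open>Unbounded operators\<close>

text \<open>An operator \<open>S\<close> in a Hilbert space is its graph: \<open>(\<xi>, \<zeta>) \<in> S\<close> means that \<open>\<xi>\<close> is in the domain
  \<open>Domain S\<close> and \<open>S\<close> maps \<open>\<xi>\<close> to \<open>\<zeta>\<close>. Equality of graphs is equality of operators, domains included.\<close>

type_synonym 'a operator = "('a \<times> 'a) set"

definition linear_operator :: "'a::complex_vector operator \<Rightarrow> bool" where
  "linear_operator S \<longleftrightarrow> single_valued S \<and> csubspace S"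

definition operator_on :: "'a set \<Rightarrow> ('a \<Rightarrow> 'a) \<Rightarrow> 'a operator" where
  "operator_on V A = {(\<xi>, A \<xi>) | \<xi>. \<xi> \<in> V}"

text \<open>The product \<open>S T\<close> of operators, with its maximal domain; \<open>T\<close> acts first.\<close>

definition operator_comp :: "'a operator \<Rightarrow> 'a operator \<Rightarrow> 'a operator" where
  "operator_comp S T = T O S"

definition adjoint_operator :: "'a::chilbert_space operator \<Rightarrow> 'a operator" where
  "adjoint_operator S = {(\<eta>, \<theta>). \<forall>(\<xi>, \<zeta>)\<in>S. cinner \<zeta> \<eta> = cinner \<xi> \<theta>}"

definition selfadjoint_operator :: "'a::chilbert_space operator \<Rightarrow> bool" where
  "selfadjoint_operator S \<longleftrightarrow>
     linear_operator S \<and> closure (Domain S) = UNIV \<and> adjoint_operator S = S"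

definition positive_operator :: "'a::chilbert_space operator \<Rightarrow> bool" where
  "positive_operator S \<longleftrightarrow> (\<forall>(\<xi>, \<zeta>)\<in>S. cinner \<zeta> \<xi> \<in> \<real>\<^sub>\<ge>\<^sub>0)"

definition is_positive_sqrt :: "'a::chilbert_space operator \<Rightarrow> 'a operator \<Rightarrow> bool" where
  "is_positive_sqrt Q S \<longleftrightarrow>
     selfadjoint_operator Q \<and> positive_operator Q \<and> operator_comp Q Q = S"

definition resolvent_set :: "'a::chilbert_space operator \<Rightarrow> complex set" where
  "resolvent_set S =
     {z. (\<forall>\<zeta>. \<exists>!\<xi>. (\<xi>, \<zeta> + z *\<^sub>C \<xi>) \<in> S) \<and>
         (\<exists>C. \<forall>(\<xi>, \<zeta>)\<in>S. norm \<xi> \<le> C * norm (\<zeta> - z *\<^sub>C \<xi>))}"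

definition associated_operator ::
    "'a::chilbert_space set \<Rightarrow> ('a \<Rightarrow> 'a \<Rightarrow> complex) \<Rightarrow> 'a operator" where
  "associated_operator D \<Omega> = {(\<xi>, \<zeta>). \<xi> \<in> D \<and> (\<forall>\<eta>\<in>D. \<Omega> \<xi> \<eta> = cinner \<zeta> \<eta>)}"

end

theory Submission
  imports Defs
begin

text \<open>For \<open>\<xi>\<close> in \<open>D\<close>, the pair \<open>(\<xi>, \<zeta>)\<close>
  lies in the graph of the associated operator exactly when
  \<open>ip\<Omega> (A \<xi>) \<eta> = cinner \<zeta> \<eta>\<close> for every \<open>\<eta>\<close>
  in \<open>D\<close>. If \<open>R\<close> maps \<open>A \<xi>\<close> to \<open>\<zeta>\<close>,
  this is the representation of \<open>ip\<Omega>\<close> by \<open>R\<close>. Conversely,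
  \<open>R\<close> is onto because 0 is in its resolvent set, so \<open>\<zeta>\<close> is the image
  of some \<open>\<upsilon>\<close>. Then \<open>A \<xi>\<close> and \<open>\<upsilon>\<close> have
  the same \<open>ip\<Omega>\<close>-products with all of \<open>D\<close>, hence coincide by
  definiteness (\<open>inner_product_on_ext\<close>). So the two graphs agree, and with them the
  domains.\<close>

lemma inner_product_on_ext:
  assumes ip: "inner_product_on V ip" and V: "csubspace V" and xy: "x \<in> V" "y \<in> V"
    and eq: "\<And>z. z \<in> V \<Longrightarrow> ip x z = ip y z"
  shows "x = y"
proof -
  have d: "x - y \<in> V"
    using V xy by (rule complex_vector.subspace_diff)
  have "sesquilinear_on V ip" and pos: "\<forall>v\<in>V. ip v v \<in> \<real>\<^sub>\<ge>\<^sub>0 \<and> (ip v v = 0 \<longrightarrow> v = 0)"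
    using ip unfolding inner_product_on_def by blast+
  then have "clinear_on V (\<lambda>v. ip v (x - y))"
    using d by (simp only: sesquilinear_on_def)
  \<comment> \<open>Writing \<open>x\<close> as \<open>y + (x - y)\<close> lets additivity on
    \<open>V\<close> apply directly; testing against \<open>x - y\<close> itself then makes this
    difference orthogonal to itself.\<close>
  then have "ip (y + (x - y)) (x - y) = ip y (x - y) + ip (x - y) (x - y)"
    using xy d by (simp only: clinear_on_def)
  then have "ip (x - y) (x - y) = 0"
    using eq[OF d] by simp
  then have "x - y = 0"
    using pos d by blast
  then show ?thesis
    by simp
qed

theorem mainTheorem10:
  fixes D :: "'a::chilbert_space set"
    and \<Omega> ip\<Omega> :: "'a \<Rightarrow> 'a \<Rightarrow> complex"
    and R sqrtR :: "'a operator"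
    and A :: "'a \<Rightarrow> 'a"
  assumes D: "csubspace D" "closure D = UNIV"
    and form: "sesquilinear_on D \<Omega>"
    and ip: "inner_product_on D ip\<Omega>"
    and solvable: "solvable D \<Omega> (induced_norm ip\<Omega>)"
    and R: "selfadjoint_operator R" "positive_operator R" "0 \<in> resolvent_set R"
    and sqrtR: "is_positive_sqrt sqrtR R"
    and domains: "Domain R \<subseteq> Domain sqrtR" "Domain sqrtR = D"
    and R_rep: "\<And>\<xi> R\<xi> \<eta>. (\<xi>, R\<xi>) \<in> R \<Longrightarrow> \<eta> \<in> D \<Longrightarrow> ip\<Omega> \<xi> \<eta> = cinner R\<xi> \<eta>"
    and sqrtR_rep: "\<And>\<xi> \<eta> S\<xi> S\<eta>. (\<xi>, S\<xi>) \<in> sqrtR \<Longrightarrow> (\<eta>, S\<eta>) \<in> sqrtR \<Longrightarrow>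
      ip\<Omega> \<xi> \<eta> = cinner S\<xi> S\<eta>"
    and A: "bounded_operator_on D (induced_norm ip\<Omega>) A"
    and A_rep: "\<And>\<xi> \<eta>. \<xi> \<in> D \<Longrightarrow> \<eta> \<in> D \<Longrightarrow> \<Omega> \<xi> \<eta> = ip\<Omega> (A \<xi>) \<eta>"
  shows "associated_operator D \<Omega> = operator_comp R (operator_on D A)
    \<and> Domain (associated_operator D \<Omega>) = Domain (operator_comp R (operator_on D A))
    \<and> Domain (operator_comp R (operator_on D A)) = {\<xi> \<in> D. A \<xi> \<in> Domain R}"
proof -
  have AD: "A \<xi> \<in> D" if "\<xi> \<in> D" for \<xi>
    using A that by (auto simp: bounded_operator_on_def)
  have comp: "operator_comp R (operator_on D A) = {(\<xi>, \<zeta>). \<xi> \<in> D \<and> (A \<xi>, \<zeta>) \<in> R}"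
    unfolding operator_comp_def operator_on_def by blast
  \<comment> \<open>At the point 0, the bijectivity clause of the resolvent set says that
    \<open>R\<close> itself is a bijection onto the whole space.\<close>
  have surj: "\<exists>\<upsilon>. (\<upsilon>, \<zeta>) \<in> R" for \<zeta>
  proof -
    have "\<exists>!\<upsilon>. (\<upsilon>, \<zeta> + 0 *\<^sub>C \<upsilon>) \<in> R"
      using R(3) by (simp only: resolvent_set_def mem_Collect_eq)
    then show ?thesis
      by auto
  qed
  have "(\<forall>\<eta>\<in>D. \<Omega> \<xi> \<eta> = cinner \<zeta> \<eta>) \<longleftrightarrow> (A \<xi>, \<zeta>) \<in> R" if \<xi>: "\<xi> \<in> D" for \<xi> \<zeta>
  proof
    assume \<zeta>: "\<forall>\<eta>\<in>D. \<Omega> \<xi> \<eta> = cinner \<zeta> \<eta>"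
    \<comment> \<open>The candidate for \<open>A \<xi>\<close> is the preimage of
      \<open>\<zeta>\<close> under \<open>R\<close>. It lies in \<open>D\<close>, the domain of the
      square root, where \<open>ip\<Omega>\<close> is definite.\<close>
    obtain \<upsilon> where \<upsilon>: "(\<upsilon>, \<zeta>) \<in> R"
      using surj by blast
    then have "\<upsilon> \<in> D"
      using domains by (metis DomainI subsetD)
    then have "A \<xi> = \<upsilon>"
    proof (rule inner_product_on_ext[OF ip D(1) AD[OF \<xi>]])
      fix \<eta> assume \<eta>: "\<eta> \<in> D"
      \<comment> \<open>Both sides equal \<open>cinner \<zeta> \<eta>\<close>: the left one through
        \<open>\<Omega>\<close>, the right one through \<open>R\<close>.\<close>
      show "ip\<Omega> (A \<xi>) \<eta> = ip\<Omega> \<upsilon> \<eta>"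
        using A_rep[OF \<xi> \<eta>] R_rep[OF \<upsilon> \<eta>] \<zeta> \<eta> by simp
    qed
    then show "(A \<xi>, \<zeta>) \<in> R"
      using \<upsilon> by simp
  next
    assume "(A \<xi>, \<zeta>) \<in> R"
    from A_rep[OF \<xi>] R_rep[OF this] show "\<forall>\<eta>\<in>D. \<Omega> \<xi> \<eta> = cinner \<zeta> \<eta>"
      by simp
  qed
  \<comment> \<open>The equivalence holds only for \<open>\<xi>\<close> in \<open>D\<close>; the
    congruence rule makes that conjunct available when rewriting the other one.\<close>
  then have "associated_operator D \<Omega> = operator_comp R (operator_on D A)"
    unfolding associated_operator_def comp by (simp cong: conj_cong)
  moreover have "Domain (operator_comp R (operator_on D A)) = {\<xi> \<in> D. A \<xi> \<in> Domain R}"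
    by (auto simp: comp)
  ultimately show ?thesis
    by simp
qed

end
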